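(* Let $P(x)$ be a product of cyclotomic polynomials and monomials (powers of $x$) that is not a single monomial. Then $m_2(P)\geq\frac{\pi^2}{12}$.
   Context: $m_2(P)=\int_0^1\log^2|P(e^{2\pi i\theta})|\,d\theta$. *)

theory Defs
  imports "HOL-Analysis.Analysis" "HOL-Computational_Algebra.Polynomial"
begin

definition primitive_roots_of_unity :: "nat \<Rightarrow> complex set" where
  "primitive_roots_of_unity n = {z. z ^ n = 1 \<and> (\<forall>m. 0 < m \<and> m < n \<longrightarrow> z ^ m \<noteq> 1)}"

text \<open>Only meaningful for \<open>n > 0\<close>: the index set is infinite when \<open>n = 0\<close>.\<close>

definition cyclotomic_poly :: "nat \<Rightarrow> complex poly" where
  "cyclotomic_poly n = (\<Prod>z\<in>primitive_roots_of_unity n. [:- z, 1:])"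

text \<open>
  At the finitely many zeros of a nonzero \<open>P\<close> on the unit circle the integrand takes the
  value \<open>(ln 0)\<^sup>2 = 0\<close>; this null set does not affect the integral.
\<close>

definition m2 :: "complex poly \<Rightarrow> real" where
  "m2 P = (LBINT \<theta>:{0..1}. (ln (cmod (poly P (exp (2 * of_real pi * \<i> * of_real \<theta>)))))\<^sup>2)"

end

theory Submission
  imports
    Defs
    "HOL-Number_Theory.Cong"
    "HOL-Complex_Analysis.Cauchy_Integral_Formula"
    "HOL-Real_Asymp.Real_Asymp"
begin

text \<open>
  Put \<open>f(\<theta>) = ln |1 - e(\<theta>)|\<close> with \<open>e(\<theta>) = exp (2 \<pi> i \<theta>)\<close>. Since \<open>x ^ n - 1\<close> is the product of the
  cyclotomic polynomials of index dividing \<open>n\<close>, \<open>ln |P(e(\<theta>))|\<close> is an integer combination of the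
  functions \<open>f(a \<theta>)\<close>, with coefficients \<open>b a\<close> that do not all vanish because \<open>P\<close> has a root on the circle.

  The identity \<open>\<Sum>j<n. f((u + j) / n) = f(u)\<close> gives
  \<open>\<integral> f(a \<theta>) f(c \<theta>) d\<theta> = gcd(a,c)\<^sup>2 / (a c) \<cdot> \<integral> f\<^sup>2\<close> over a period, and the mean value property of
  \<open>Ln(1 - z)\<^sup>2\<close>, which vanishes at \<open>0\<close>, gives \<open>\<integral> f\<^sup>2 = \<integral> (\<pi> (\<theta> - 1/2))\<^sup>2 d\<theta> = \<pi>\<^sup>2 / 12\<close>.

  It remains to see that the form \<open>\<Sum> b a \<cdot> b c \<cdot> gcd(a,c)\<^sup>2 / (a c)\<close> is at least \<open>1\<close> on nonzero integer
  vectors. Identifying \<open>a\<close> with the set of prime powers dividing it, the kernel becomes the product of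
  \<open>1 / p\<close> over the symmetric difference, so the form is the restriction of a tensor product of the
  matrices with rows \<open>(1, \<rho>)\<close> and \<open>(\<rho>, 1)\<close>, \<open>\<rho> = 1 / p \<le> 1/2\<close>. Splitting off one factor,
  \<open>Q(u, w) = \<rho> Q'(u + w) + (1 - \<rho>) (Q'(u) + Q'(w))\<close>, which is at least \<open>2 (1 - \<rho>) \<ge> 1\<close> if \<open>u\<close> and \<open>w\<close> are
  both nonzero, and equals \<open>Q'(u)\<close> or \<open>Q'(w)\<close> otherwise.
\<close>

section \<open>The greatest common divisor form on integer vectors\<close>

lemma cube_form_ge_1:
  fixes b :: "'a set \<Rightarrow> int" and \<rho> :: "'a \<Rightarrow> real"
  assumes "finite E" and "\<And>e. e \<in> E \<Longrightarrow> 0 \<le> \<rho> e \<and> \<rho> e \<le> 1 / 2"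
    and "\<exists>S\<in>Pow E. b S \<noteq> 0"
  shows "1 \<le> (\<Sum>S\<in>Pow E. \<Sum>T\<in>Pow E. of_int (b S) * of_int (b T) * (\<Prod>e\<in>sym_diff S T. \<rho> e))"
  using assms
proof (induction E arbitrary: b rule: finite_induct)
  case empty
  then have "1 \<le> (b {})\<^sup>2"
    by (simp add: int_one_le_iff_zero_less)
  then have "1 \<le> real_of_int ((b {})\<^sup>2)"
    by linarith
  then show ?case
    by (simp add: power2_eq_square)
next
  case (insert x E)
  define k where "k S T = (\<Prod>e\<in>sym_diff S T. \<rho> e)" for S T
  define B where "B u w = (\<Sum>S\<in>Pow E. \<Sum>T\<in>Pow E.
    real_of_int (u S) * of_int (w T) * k S T)" for u w :: "'a set \<Rightarrow> int"
  have IH: "1 \<le> B u u" if "\<exists>S\<in>Pow E. u S \<noteq> 0" for u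
    unfolding B_def k_def by (rule insert.IH) (use insert.prems that in auto)
  have zero: "B u w = 0 \<and> B w u = 0" if "\<forall>S\<in>Pow E. u S = 0" for u w
    using that unfolding B_def by simp
  \<comment> \<open>Semidefiniteness on integer vectors is read off from the induction hypothesis:
    the value is at least 1 or, for a vector vanishing on \<open>Pow E\<close>, equal to 0.\<close>
  have nonneg: "0 \<le> B u u" for u
    using IH[of u] zero[of u u] by (cases "\<exists>S\<in>Pow E. u S \<noteq> 0") auto
  \<comment> \<open>\<open>u\<close> and \<open>w\<close> are the two halves of \<open>b\<close>, on
    the subsets without \<open>x\<close> and on those with \<open>x\<close>.\<close>
  define u where "u = b"
  define w where "w S = b (insert x S)" for S
  have "inj_on (insert x) (Pow E)"
    using insert.hyps by (auto simp: inj_on_def)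
  then have split: "(\<Sum>S\<in>Pow (insert x E). g S) = (\<Sum>S\<in>Pow E. g S + g (insert x S))" for g :: "'a set \<Rightarrow> real"
    unfolding Pow_insert using insert.hyps
    by (subst sum.union_disjoint) (auto simp: sum.reindex sum.distrib)
  have fin: "finite S" if "S \<in> Pow E" for S
    using that insert.hyps finite_subset by auto
  have eqs: "k (insert x S) (insert x T) = k S T"
       "k (insert x S) T = \<rho> x * k S T"
       "k S (insert x T) = \<rho> x * k S T"
    if "S \<in> Pow E" "T \<in> Pow E" for S T
  proof -
    have "x \<notin> S" "x \<notin> T" using that insert.hyps by auto
    then have "sym_diff (insert x S) T = insert x (sym_diff S T)" "x \<notin> sym_diff S T"
      "sym_diff S (insert x T) = insert x (sym_diff S T)" "sym_diff (insert x S) (insert x T) = sym_diff S T"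
      by auto
    then show "k (insert x S) (insert x T) = k S T"
       "k (insert x S) T = \<rho> x * k S T"
       "k S (insert x T) = \<rho> x * k S T"
      unfolding k_def using fin[OF that(1)] fin[OF that(2)] by simp_all
  qed
  \<comment> \<open>The mixed terms carry the factor \<open>\<rho> x\<close>. Polarisation replaces
    them by the form at \<open>u + w\<close> minus the forms at \<open>u\<close> and at
    \<open>w\<close>, so that only squares with nonnegative weights remain.\<close>
  have "(\<Sum>S\<in>Pow (insert x E). \<Sum>T\<in>Pow (insert x E).
      of_int (b S) * of_int (b T) * k S T)
    = (\<Sum>S\<in>Pow E. \<Sum>T\<in>Pow E.
         \<rho> x * (of_int (u S + w S) * of_int (u T + w T) * k S T)
       + (1 - \<rho> x) * (of_int (u S) * of_int (u T) * k S T
                      + of_int (w S) * of_int (w T) * k S T))"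
    unfolding split sum.distrib[symmetric]
    by (intro sum.cong refl) (simp add: eqs u_def w_def algebra_simps)
  also have "\<dots> = \<rho> x * B (\<lambda>S. u S + w S) (\<lambda>S. u S + w S) + (1 - \<rho> x) * (B u u + B w w)"
    unfolding B_def by (simp only: sum.distrib sum_distrib_left[symmetric] distrib_left[symmetric])
  also have "\<dots> \<ge> 1"
  proof -
    have \<rho>: "0 \<le> \<rho> x" "\<rho> x \<le> 1 / 2" using insert.prems(1) by auto
    consider "\<forall>S\<in>Pow E. u S = 0" "\<exists>S\<in>Pow E. w S \<noteq> 0" | "\<forall>S\<in>Pow E. w S = 0" "\<exists>S\<in>Pow E. u S \<noteq> 0"
      | "\<exists>S\<in>Pow E. u S \<noteq> 0" "\<exists>S\<in>Pow E. w S \<noteq> 0"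
      using insert.prems(2) unfolding Pow_insert u_def w_def by blast
    then show ?thesis
    proof cases
      case 1
      then have "B (\<lambda>S. u S + w S) (\<lambda>S. u S + w S) = B w w" by (simp add: B_def)
      then show ?thesis using IH[OF 1(2)] zero[OF 1(1), of u] by (simp add: algebra_simps)
    next
      case 2
      then have "B (\<lambda>S. u S + w S) (\<lambda>S. u S + w S) = B u u" by (simp add: B_def)
      then show ?thesis using IH[OF 2(2)] zero[OF 2(1), of w] by (simp add: algebra_simps)
    next
      case 3
      \<comment> \<open>The bound \<open>\<rho> x \<le> 1 / 2\<close> enters here: two halves, each
        contributing at least 1, compensate for the weight \<open>1 - \<rho> x\<close>.\<close>
      have "1 \<le> (1 - \<rho> x) * 2" using \<rho> by simp
      also have "\<dots> \<le> (1 - \<rho> x) * (B u u + B w w)"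
        using \<rho> IH[OF 3(1)] IH[OF 3(2)] by (intro mult_left_mono) auto
      finally show ?thesis using \<rho> nonneg[of "\<lambda>S. u S + w S"] by (simp add: add_increasing)
    qed
  qed
  finally show ?case
    unfolding k_def .
qed

section \<open>Encoding of positive integers by their prime power divisors\<close>

text \<open>Pairs are used instead of the powers \<open>p ^ i\<close> so that the weight
  \<open>1 / p\<close> of an element can be read off its first component.\<close>

definition prime_power_divisors :: "nat \<Rightarrow> (nat \<times> nat) set" where
  "prime_power_divisors a = {(p, i). prime p \<and> 0 < i \<and> p ^ i dvd a}"

lemma prime_power_divisors_Sigma:
  assumes "a > 0"
  shows "prime_power_divisors a = (SIGMA p:prime_factors a. {1..multiplicity p a})"
proof -
  have "prime p \<and> 0 < i \<and> p ^ i dvd a \<longleftrightarrow> p \<in> prime_factors a \<and> i \<in> {1..multiplicity p a}" for p i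
  proof (cases "prime p")
    case True
    have "p ^ i dvd a \<longleftrightarrow> i \<le> multiplicity p a"
      using True assms by (intro power_dvd_iff_le_multiplicity) auto
    moreover have "p dvd a" if "0 < i" "p ^ i dvd a"
      using that dvd_power dvd_trans by blast
    ultimately show ?thesis
      using True assms by (auto simp: prime_factors_dvd)
  qed auto
  then show ?thesis
    unfolding prime_power_divisors_def by auto
qed

lemma finite_prime_power_divisors: "a > 0 \<Longrightarrow> finite (prime_power_divisors a)"
  by (simp add: prime_power_divisors_Sigma)

text \<open>Each prime occurs once for every exponent up to its multiplicity. The formula also shows
  that the encoding is injective on positive integers.\<close>

lemma prod_prime_power_divisors:
  assumes "a > 0"
  shows "(\<Prod>(p, i)\<in>prime_power_divisors a. p) = a"
proof -
  have "(\<Prod>(p, i)\<in>prime_power_divisors a. p) = (\<Prod>p\<in>prime_factors a. \<Prod>i\<in>{1..multiplicity p a}. p)"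
    using assms by (subst prod.Sigma) (simp_all add: prime_power_divisors_Sigma)
  also have "\<dots> = a"
    using assms by (simp add: prime_factorization_nat[symmetric])
  finally show ?thesis .
qed

text \<open>Intersecting the encodings gives the encoding of the gcd \<open>g\<close>. The two
  differences therefore have products \<open>a / g\<close> and \<open>c / g\<close>, and the kernel
  is the reciprocal of the product of these quotients.\<close>

lemma gcd_kernel_eq_prod:
  assumes "a > 0" "c > 0"
  shows "(real (gcd a c))\<^sup>2 / (real a * real c)
    = (\<Prod>e\<in>sym_diff (prime_power_divisors a) (prime_power_divisors c). 1 / real (fst e))"
proof -
  let ?D = prime_power_divisors
  let ?g = "\<lambda>e. real (fst e)"
  have fin: "finite (?D a)" "finite (?D c)"
    using assms by (auto intro: finite_prime_power_divisors)
  have prod: "prod ?g (?D n) = real n" if "n > 0" for n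
    using arg_cong[OF prod_prime_power_divisors[OF that], of real] by (simp add: case_prod_beta)
  have int: "?D a \<inter> ?D c = ?D (gcd a c)"
    by (auto simp: prime_power_divisors_def)
  have g: "prod ?g (?D a \<inter> ?D c) = real (gcd a c)"
    unfolding int using assms by (intro prod) auto
  have 1: "real a = prod ?g (?D a - ?D c) * real (gcd a c)"
    unfolding g[symmetric] prod[OF assms(1), symmetric]
    by (subst prod.union_disjoint[symmetric]) (auto simp: fin intro!: prod.cong)
  have 2: "real c = prod ?g (?D c - ?D a) * real (gcd a c)"
    unfolding g[symmetric] prod[OF assms(2), symmetric]
    by (subst prod.union_disjoint[symmetric]) (auto simp: fin intro!: prod.cong)
  have "(\<Prod>e\<in>sym_diff (?D a) (?D c). 1 / ?g e) = 1 / (prod ?g (?D a - ?D c) * prod ?g (?D c - ?D a))"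
    by (subst prod.union_disjoint) (auto simp: fin prod_dividef)
  also have "\<dots> = (real (gcd a c))\<^sup>2 / (real a * real c)"
  proof -
    have "gcd a c \<noteq> 0" using assms by auto
    then show ?thesis by (subst 1, subst 2) (simp add: power2_eq_square)
  qed
  finally show ?thesis by simp
qed

lemma gcd_form_ge_1:
  fixes b :: "nat \<Rightarrow> int"
  assumes "finite A" and pos: "\<And>a. a \<in> A \<Longrightarrow> a > 0" and "\<exists>a\<in>A. b a \<noteq> 0"
  shows "1 \<le> (\<Sum>a\<in>A. \<Sum>c\<in>A. of_int (b a) * of_int (b c) * ((real (gcd a c))\<^sup>2 / (real a * real c)))"
proof -
  let ?D = prime_power_divisors
  define E where "E = (\<Union>a\<in>A. ?D a)"
  define k where "k S T = (\<Prod>e\<in>sym_diff S T. 1 / real (fst e))" for S T :: "(nat \<times> nat) set"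
  \<comment> \<open>The vector is transported to subsets of \<open>E\<close> by summing over the
    fibres of the encoding. Injectivity makes the fibre of a nonzero entry a singleton, so nothing
    cancels there.\<close>
  define b' where "b' S = (\<Sum>a\<in>{a\<in>A. ?D a = S}. b a)" for S
  have E: "finite E" "?D ` A \<subseteq> Pow E"
    unfolding E_def using assms finite_prime_power_divisors by auto
  have inj: "inj_on ?D A"
    by (metis inj_onI pos prod_prime_power_divisors)
  obtain a where a: "a \<in> A" "b a \<noteq> 0" using assms by auto
  have "{a'\<in>A. ?D a' = ?D a} = {a}"
    using a inj by (auto simp: inj_on_def)
  then have "b' (?D a) \<noteq> 0" unfolding b'_def using a by simp
  then have nz: "\<exists>S\<in>Pow E. b' S \<noteq> 0" using a E by blast
  have "1 \<le> (\<Sum>S\<in>Pow E. \<Sum>T\<in>Pow E. of_int (b' S) * of_int (b' T) * k S T)"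
    unfolding k_def
  proof (rule cube_form_ge_1[OF E(1) _ nz])
    fix e assume "e \<in> E"
    then have "prime (fst e)" unfolding E_def prime_power_divisors_def by auto
    then have "2 \<le> real (fst e)" using prime_ge_2_nat by fastforce
    then show "0 \<le> 1 / real (fst e) \<and> 1 / real (fst e) \<le> 1 / 2" by (simp add: field_simps)
  qed
  \<comment> \<open>The double sum is pulled back from subsets to integers one variable at a time,
    first \<open>T\<close> and then \<open>S\<close>.\<close>
  also have "\<dots> = (\<Sum>S\<in>Pow E. of_int (b' S) * (\<Sum>c\<in>A. of_int (b c) * k S (?D c)))"
  proof (rule sum.cong[OF refl])
    fix S
    have "(\<Sum>c\<in>A. of_int (b c) * k S (?D c)) = (\<Sum>T\<in>Pow E. \<Sum>c\<in>{c\<in>A. ?D c = T}. of_int (b c) * k S (?D c))"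
      using E assms by (intro sum.group[symmetric]) auto
    also have "\<dots> = (\<Sum>T\<in>Pow E. of_int (b' T) * k S T)"
      by (intro sum.cong refl) (simp add: b'_def sum_distrib_right)
    finally show "(\<Sum>T\<in>Pow E. of_int (b' S) * of_int (b' T) * k S T)
      = of_int (b' S) * (\<Sum>c\<in>A. of_int (b c) * k S (?D c))"
      by (simp add: sum_distrib_left mult.assoc)
  qed
  also have "\<dots> = (\<Sum>a\<in>A. of_int (b a) * (\<Sum>c\<in>A. of_int (b c) * k (?D a) (?D c)))"
  proof -
    let ?h = "\<lambda>S. \<Sum>c\<in>A. of_int (b c) * k S (?D c)"
    have "(\<Sum>a\<in>A. of_int (b a) * ?h (?D a)) = (\<Sum>S\<in>Pow E. \<Sum>a\<in>{a\<in>A. ?D a = S}. of_int (b a) * ?h (?D a))"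
      using E assms by (intro sum.group[symmetric]) auto
    also have "\<dots> = (\<Sum>S\<in>Pow E. of_int (b' S) * ?h S)"
      by (intro sum.cong refl) (simp add: b'_def sum_distrib_right)
    finally show ?thesis by simp
  qed
  also have "\<dots> = (\<Sum>a\<in>A. \<Sum>c\<in>A. of_int (b a) * of_int (b c) * ((real (gcd a c))\<^sup>2 / (real a * real c)))"
    unfolding sum_distrib_left
  proof (intro sum.cong refl)
    fix a c assume "a \<in> A" "c \<in> A"
    then have "(real (gcd a c))\<^sup>2 / (real a * real c) = k (?D a) (?D c)"
      unfolding k_def by (intro gcd_kernel_eq_prod pos)
    then show "of_int (b a) * (of_int (b c) * k (?D a) (?D c)) = of_int (b a) * of_int (b c) * ((real (gcd a c))\<^sup>2 / (real a * real c))"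
      by simp
  qed
  finally show ?thesis .
qed

section \<open>Correlations of dilated logarithmic chords\<close>

text \<open>The intervals from \<open>j / n\<close> to \<open>(j + 1) / n\<close> tile the unit
  interval; taking them half-open makes the identity exact at every point, with
  \<open>j = \<lfloor>n \<theta>\<rfloor>\<close> the only nonzero term.\<close>

lemma indicator_unit_interval_split:
  assumes "n > 0"
  shows "indicator {0..<1} \<theta> = (\<Sum>j<n. indicator {0..<1} (real n * \<theta> - real j) :: real)"
proof (cases "\<theta> \<in> {0..<1}")
  case True
  define k where "k = nat \<lfloor>real n * \<theta>\<rfloor>"
  have k: "real k \<le> real n * \<theta>" "real n * \<theta> < real k + 1"
    unfolding k_def using True by (auto simp: of_nat_nat)
  have "real n * \<theta> < real n"
    using True assms by simp
  then have "k < n"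
    using k by linarith
  have "indicator {0..<1} (real n * \<theta> - real j) = (if j = k then 1 else 0 :: real)" for j
    using k by (auto simp: indicator_def)
  then show ?thesis
    using \<open>k < n\<close> True by simp
next
  case False
  have "real n * \<theta> - real j \<notin> {0..<1}" if "j < n" for j
  proof
    assume *: "real n * \<theta> - real j \<in> {0..<1}"
    have "real j + 1 \<le> real n"
      using that by linarith
    then have "0 \<le> real n * \<theta>" "real n * \<theta> < real n * 1"
      using * unfolding atLeastLessThan_iff mult_1_right by linarith+
    moreover have "real n * \<theta> < 0" if "\<theta> < 0"
      using that assms by (simp add: mult_pos_neg)
    moreover have "real n * 1 \<le> real n * \<theta>" if "1 \<le> \<theta>"
      using that by (intro mult_left_mono) auto
    ultimately show False
      using False by fastforce
  qed
  then show ?thesis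
    using False by simp
qed

text \<open>Each of the \<open>n\<close> pieces is mapped onto the unit interval by the substitution
  \<open>\<theta> = (u + j) / n\<close>, whose Jacobian is \<open>1 / n\<close>.\<close>

lemma set_integral_split_rescale:
  fixes F :: "real \<Rightarrow> real"
  assumes "n > 0" and F: "set_integrable lborel {0..<1} F"
  shows "set_lebesgue_integral lborel {0..<1} F
    = (LBINT u:{0..<1}. (\<Sum>j<n. F ((u + real j) / real n))) / real n"
proof -
  define G where "G j \<theta> = indicator {0..<1} (real n * \<theta> - real j) * F \<theta>" for j \<theta>
  \<comment> \<open>The \<open>j\<close>-th piece lies inside the unit interval, so its indicator
    absorbs the other one. This form gives measurability and a majorant for \<open>G j\<close>,
    since \<open>F\<close> is controlled only on the unit interval.\<close>
  have G_eq: "G j \<theta> = indicator {0..<1} (real n * \<theta> - real j) * (indicator {0..<1} \<theta> *\<^sub>R F \<theta>)" if "j < n" for j \<theta>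
  proof (cases "\<theta> \<in> {0..<1}")
    case False
    then have "(\<Sum>j<n. indicator {0..<1} (real n * \<theta> - real j) :: real) = 0"
      using indicator_unit_interval_split[OF \<open>n > 0\<close>, of \<theta>] by simp
    then have "indicator {0..<1} (real n * \<theta> - real j) = (0::real)"
      using that by (subst (asm) sum_nonneg_eq_0_iff) auto
    then show ?thesis
      by (simp add: G_def)
  qed (simp add: G_def)
  have int_G: "integrable lborel (G j)" if "j < n" for j
  proof (rule Bochner_Integration.integrable_bound)
    show "integrable lborel (\<lambda>\<theta>. indicator {0..<1} \<theta> *\<^sub>R F \<theta>)"
      using F by (simp add: set_integrable_def)
    then have [measurable]: "(\<lambda>\<theta>. indicator {0..<1} \<theta> *\<^sub>R F \<theta>) \<in> borel_measurable lborel"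
      by (rule borel_measurable_integrable)
    show "G j \<in> borel_measurable lborel"
      unfolding G_eq[OF that, abs_def] by measurable
    show "AE \<theta> in lborel. norm (G j \<theta>) \<le> norm (indicator {0..<1} \<theta> *\<^sub>R F \<theta>)"
      unfolding G_eq[OF that] by (auto simp: indicator_def)
  qed
  have shift: "G j (real j / real n + 1 / real n * u) = indicator {0..<1} u *\<^sub>R F ((u + real j) / real n)" for j u
    using \<open>n > 0\<close> by (simp add: G_def field_simps)
  have "set_lebesgue_integral lborel {0..<1} F = (LBINT \<theta>. \<Sum>j<n. G j \<theta>)"
    unfolding set_lebesgue_integral_def G_def
    by (subst indicator_unit_interval_split[OF \<open>n > 0\<close>]) (simp add: sum_distrib_right)
  also have "\<dots> = (\<Sum>j<n. LBINT \<theta>. G j \<theta>)"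
    using int_G by (intro Bochner_Integration.integral_sum) auto
  also have "\<dots> = (\<Sum>j<n. (LBINT u. indicator {0..<1} u *\<^sub>R F ((u + real j) / real n)) / real n)"
  proof (rule sum.cong[OF refl])
    fix j
    have "integral\<^sup>L lborel (G j) = \<bar>1 / real n\<bar> *\<^sub>R (LBINT u. G j (real j / real n + 1 / real n * u))"
      using \<open>n > 0\<close> by (intro lborel_integral_real_affine) simp
    then show "integral\<^sup>L lborel (G j) = (LBINT u. indicator {0..<1} u *\<^sub>R F ((u + real j) / real n)) / real n"
      unfolding shift by simp
  qed
  also have "\<dots> = (LBINT u. \<Sum>j<n. indicator {0..<1} u *\<^sub>R F ((u + real j) / real n)) / real n"
    unfolding sum_divide_distrib[symmetric]
  proof (subst Bochner_Integration.integral_sum)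
    fix j assume "j \<in> {..<n}"
    then show "integrable lborel (\<lambda>u. indicator {0..<1} u *\<^sub>R F ((u + real j) / real n))"
      using lborel_integrable_real_affine[OF int_G, of j "1 / real n" "real j / real n"] \<open>n > 0\<close>
      unfolding shift by simp
  qed simp
  finally show ?thesis
    by (simp add: set_lebesgue_integral_def sum_distrib_left)
qed

lemma periodic_add_of_nat:
  fixes h :: "real \<Rightarrow> 'a"
  assumes "\<And>x. h (x + 1) = h x"
  shows "h (x + real j) = h x"
proof (induction j)
  case (Suc j)
  then show ?case using assms[of "x + real j"] by (simp add: add_ac)
qed simp

text \<open>By periodicity the dilated function is, on the \<open>j\<close>-th piece, an affine copy
  of \<open>h\<close> on one period, so it is a finite sum of integrable functions.\<close>

lemma set_integrable_periodic_rescale: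
  fixes h :: "real \<Rightarrow> real"
  assumes "n > 0" and per: "\<And>x. h (x + 1) = h x" and h: "set_integrable lborel {0..<1} h"
  shows "set_integrable lborel {0..<1} (\<lambda>\<theta>. h (real n * \<theta>))"
proof -
  have "h (real n * \<theta>) = h (real n * \<theta> - real j)" for j \<theta>
    using periodic_add_of_nat[of h "real n * \<theta> - real j" j] per by simp
  then have "indicator {0..<1} \<theta> *\<^sub>R h (real n * \<theta>)
    = (\<Sum>j<n. indicator {0..<1} (- real j + real n * \<theta>) *\<^sub>R h (- real j + real n * \<theta>))" for \<theta>
    by (subst indicator_unit_interval_split[OF \<open>n > 0\<close>]) (simp add: sum_distrib_right)
  moreover have "integrable lborel (\<lambda>\<theta>. \<Sum>j<n. indicator {0..<1} (- real j + real n * \<theta>) *\<^sub>R h (- real j + real n * \<theta>))"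
    using h \<open>n > 0\<close> unfolding set_integrable_def
    by (intro Bochner_Integration.integrable_sum lborel_integrable_real_affine[of "\<lambda>x. indicator {0..<1} x *\<^sub>R h x"]) auto
  ultimately show ?thesis
    unfolding set_integrable_def by presburger
qed

lemma set_integral_periodic_rescale:
  fixes h :: "real \<Rightarrow> real"
  assumes "n > 0" and per: "\<And>x. h (x + 1) = h x" and h: "set_integrable lborel {0..<1} h"
  shows "(LBINT \<theta>:{0..<1}. h (real n * \<theta>)) = (LBINT \<theta>:{0..<1}. h \<theta>)"
proof -
  have "h (real n * ((u + real j) / real n)) = h u" for u j
    using \<open>n > 0\<close> periodic_add_of_nat[of h u j] per by simp
  then show ?thesis
    using assms by (subst set_integral_split_rescale[OF \<open>n > 0\<close>]) (auto intro: set_integrable_periodic_rescale)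
qed

section \<open>The logarithmic chord and its distribution relation\<close>

text \<open>The logarithm of the length of the chord from 1 to a point of the unit circle. At
  integers the chord degenerates and the value is \<open>ln 0 = 0\<close>.\<close>

definition log_chord :: "real \<Rightarrow> real" where
  "log_chord \<theta> = ln (cmod (1 - cis (2 * pi * \<theta>)))"

lemma cis_eq_1_imp_Ints: "cis (2 * pi * \<theta>) = 1 \<Longrightarrow> \<theta> \<in> \<int>"
proof -
  assume "cis (2 * pi * \<theta>) = 1"
  then have "cos (2 * pi * \<theta>) = 1"
    by (metis Re_complex_of_real cis.sel(1) of_real_1)
  then obtain m :: int where "2 * pi * \<theta> = real_of_int m * 2 * pi"
    unfolding cos_one_2pi_int by blast
  then have "\<theta> = real_of_int m" by simp
  then show ?thesis by simp
qed

lemma log_chord_add_1: "log_chord (x + 1) = log_chord x"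
  by (simp add: log_chord_def distrib_left cis_mult[symmetric])

lemma log_chord_measurable [measurable]: "log_chord \<in> borel_measurable borel"
proof -
  have "(\<lambda>\<theta>. cmod (1 - cis (2 * pi * \<theta>))) \<in> borel_measurable borel"
    by (intro borel_measurable_continuous_onI continuous_intros)
  then show ?thesis
    unfolding log_chord_def[abs_def] by measurable
qed

text \<open>Both sides are monic polynomials of degree \<open>n\<close> in \<open>y\<close> that
  agree at the \<open>n\<close> roots of unity.\<close>

lemma power_minus_1_eq_prod_roots:
  fixes y :: complex
  assumes "n > 0"
  shows "y ^ n - 1 = (\<Prod>z | z ^ n = 1. y - z)"
proof -
  define R where "R = {z::complex. z ^ n = 1}"
  have R: "finite R" "card R = n"
    unfolding R_def using assms by (auto simp: card_roots_unity_eq finite_roots_unity)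
  define p where "p = (\<Prod>z\<in>R. [:- z, 1:])"
  define q where "q = monom 1 n - (1 :: complex poly)"
  have "degree (\<Prod>z\<in>R. [:- z, 1:]) = (\<Sum>z\<in>R. degree [:- z, 1:])"
    by (intro degree_prod_eq_sum_degree) auto
  then have p: "degree p = n" "lead_coeff p = 1"
    unfolding p_def using R by (auto simp: lead_coeff_prod)
  have cq: "coeff q n = 1"
    using assms by (simp add: q_def coeff_1)
  have "degree q \<le> n"
    unfolding q_def by (intro degree_diff_le) (auto simp: degree_monom_le)
  moreover have "n \<le> degree q"
    using cq by (intro le_degree) simp
  ultimately have q: "degree q = n" "lead_coeff q = 1"
    using cq by auto
  have "p = q"
  proof (rule poly_eqI_degree_lead_coeff[where A = R and n = n])
    show "poly p x = poly q x" if "x \<in> R" for x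
      using that R unfolding p_def q_def by (auto simp: poly_prod poly_monom R_def)
  qed (use p q R in auto)
  then have "poly p y = poly q y" by simp
  then show ?thesis
    by (simp add: p_def q_def poly_prod poly_monom R_def)
qed

text \<open>This is the logarithm of the factorisation of \<open>y ^ n - 1\<close> at a point of the
  circle. Excluding integers keeps every factor nonzero, so that \<open>ln\<close> turns the product
  into a sum.\<close>

lemma sum_log_chord_division_points:
  assumes "n > 0" "u \<notin> \<int>"
  shows "(\<Sum>j<n. log_chord ((u + real j) / real n)) = log_chord u"
proof -
  \<comment> \<open>The minus sign makes \<open>y\<close> times
    \<open>cis (2 * pi * ((u + real j) / real n))\<close> the \<open>j\<close>-th root of unity;
    pulling out \<open>y\<close>, of modulus 1, leaves a chord.\<close>
  define y where "y = cis (- (2 * pi * u / real n))"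
  have dist: "cmod (y - cis (2 * pi * real j / real n)) = cmod (1 - cis (2 * pi * ((u + real j) / real n)))" for j
  proof -
    have "y - cis (2 * pi * real j / real n) = y * (1 - cis (2 * pi * ((u + real j) / real n)))"
      using assms(1) unfolding y_def by (simp add: right_diff_distrib cis_mult add_divide_distrib distrib_left)
    then show ?thesis
      by (simp add: norm_mult y_def)
  qed
  have yn: "y ^ n = cis (- (2 * pi * u))"
    using assms(1) unfolding y_def Complex.DeMoivre by simp
  have "cmod (1 - cis (2 * pi * u)) = cmod (y ^ n - 1)"
  proof -
    have "y ^ n - 1 = y ^ n * (1 - cis (2 * pi * u))"
      unfolding yn by (simp add: right_diff_distrib cis_mult)
    then show ?thesis
      by (simp add: norm_mult norm_power y_def)
  qed
  also have "\<dots> = (\<Prod>j<n. cmod (y - cis (2 * pi * real j / real n)))"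
    unfolding power_minus_1_eq_prod_roots[OF assms(1)] prod_norm
    by (subst prod.reindex_bij_betw[OF Complex.bij_betw_roots_unity[OF assms(1)], symmetric]) simp
  also have "\<dots> = (\<Prod>j<n. cmod (1 - cis (2 * pi * ((u + real j) / real n))))"
    by (simp only: dist)
  finally have eq: "cmod (1 - cis (2 * pi * u)) = (\<Prod>j<n. cmod (1 - cis (2 * pi * ((u + real j) / real n))))" .
  have "cmod (1 - cis (2 * pi * u)) \<noteq> 0"
    using assms(2) cis_eq_1_imp_Ints[of u] by auto
  then have "cmod (1 - cis (2 * pi * ((u + real j) / real n))) > 0" if "j < n" for j
    using that unfolding eq by auto
  then show ?thesis
    unfolding log_chord_def eq by (subst ln_prod) auto
qed

text \<open>Multiplication by \<open>a\<close> permutes the residues modulo \<open>n\<close>, and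
  multiples of \<open>n\<close> in the numerator disappear by periodicity.\<close>

lemma sum_log_chord_division_points_coprime:
  assumes "n > 0" "u \<notin> \<int>" "coprime a n"
  shows "(\<Sum>j<n. log_chord ((u + real (a * j)) / real n)) = log_chord u"
proof -
  have "inj_on (\<lambda>j. a * j mod n) {..<n}"
  proof (rule inj_onI)
    fix i j assume "i \<in> {..<n}" "j \<in> {..<n}" "a * i mod n = a * j mod n"
    then have "[i = j] (mod n)"
      using assms(3) by (simp add: cong_def[symmetric] cong_mult_lcancel_nat)
    then show "i = j"
      using \<open>i \<in> {..<n}\<close> \<open>j \<in> {..<n}\<close> by (simp add: cong_def)
  qed
  moreover have "(\<lambda>j. a * j mod n) ` {..<n} \<subseteq> {..<n}"
    using assms(1) by auto
  ultimately have bij: "bij_betw (\<lambda>j. a * j mod n) {..<n} {..<n}"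
    by (simp add: bij_betw_def endo_inj_surj)
  have "log_chord ((u + real (a * j)) / real n) = log_chord ((u + real (a * j mod n)) / real n)" for j
  proof -
    have "real (a * j) = real n * real (a * j div n) + real (a * j mod n)"
      by (metis mult_div_mod_eq of_nat_add of_nat_mult)
    then have "(u + real (a * j)) / real n = (u + real (a * j mod n)) / real n + real (a * j div n)"
      using assms(1) by (simp add: field_simps)
    then show ?thesis
      by (simp only: periodic_add_of_nat[of log_chord, OF log_chord_add_1])
  qed
  then have "(\<Sum>j<n. log_chord ((u + real (a * j)) / real n)) = (\<Sum>j<n. log_chord ((u + real (a * j mod n)) / real n))"
    by simp
  also have "\<dots> = (\<Sum>j<n. log_chord ((u + real j) / real n))"
    by (rule sum.reindex_bij_betw[OF bij])
  finally show ?thesis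
    using sum_log_chord_division_points[OF assms(1,2)] by simp
qed

section \<open>Integrals of products of two dilated chords\<close>

text \<open>A single null set that contains the singular points of all dilates
  \<open>log_chord (real a * \<theta>)\<close> with \<open>a > 0\<close>.\<close>

lemma AE_irrational: "AE \<theta> in lborel. \<theta> \<notin> (\<rat> :: real set)"
  by (intro AE_not_in countable_imp_null_set_lborel countable_rat)

text \<open>The product is dominated by the sum of the squares. Square integrability is a hypothesis
  until \<open>set_integral_log_chord_square\<close> supplies it.\<close>

lemma set_integrable_log_chord_mult:
  assumes sq: "set_integrable lborel {0..<1} (\<lambda>\<theta>. (log_chord \<theta>)\<^sup>2)" and "a > 0" "c > 0"
  shows "set_integrable lborel {0..<1} (\<lambda>\<theta>. log_chord (real a * \<theta>) * log_chord (real c * \<theta>))"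
proof -
  have *: "set_integrable lborel {0..<1} (\<lambda>\<theta>. (log_chord (real n * \<theta>))\<^sup>2)" if "n > 0" for n
    using that sq by (intro set_integrable_periodic_rescale[of n "\<lambda>\<theta>. (log_chord \<theta>)\<^sup>2"]) (simp_all add: log_chord_add_1)
  have "set_integrable lborel {0..<1} (\<lambda>\<theta>. (log_chord (real a * \<theta>))\<^sup>2 + (log_chord (real c * \<theta>))\<^sup>2)"
    by (intro set_integral_add * assms)
  then show ?thesis
  proof (rule set_integrable_bound)
    show "set_borel_measurable lborel {0..<1} (\<lambda>\<theta>. log_chord (real a * \<theta>) * log_chord (real c * \<theta>))"
      unfolding set_borel_measurable_def by measurable
    have "\<bar>x * y\<bar> \<le> x\<^sup>2 + y\<^sup>2" for x y :: real
    proof -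
      have "2 * (\<bar>x\<bar> * \<bar>y\<bar>) \<le> x\<^sup>2 + y\<^sup>2" "0 \<le> \<bar>x\<bar> * \<bar>y\<bar>"
        using sum_squares_bound[of "\<bar>x\<bar>" "\<bar>y\<bar>"] by simp_all
      then show ?thesis
        unfolding abs_mult by linarith
    qed
    then show "AE \<theta> in lborel. \<theta> \<in> {0..<1} \<longrightarrow> norm (log_chord (real a * \<theta>) * log_chord (real c * \<theta>))
        \<le> norm ((log_chord (real a * \<theta>))\<^sup>2 + (log_chord (real c * \<theta>))\<^sup>2)"
      by simp
  qed
qed

lemma Rats_if_of_nat_mult_Ints: "real a * u \<in> \<int> \<Longrightarrow> a > 0 \<Longrightarrow> u \<in> \<rat>"
proof -
  assume "real a * u \<in> \<int>" "a > 0"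
  then obtain m where "u = of_int m / of_nat a"
    by (auto elim!: Ints_cases simp: field_simps)
  then show ?thesis by simp
qed

text \<open>Cutting the period into \<open>c\<close> pieces freezes the factor dilated by
  \<open>c\<close>, while the other factor runs through division points with step \<open>a\<close>
  and is summed by the distribution relation.\<close>

lemma set_integral_log_chord_mult_coprime:
  assumes sq: "set_integrable lborel {0..<1} (\<lambda>\<theta>. (log_chord \<theta>)\<^sup>2)" and "a > 0" "c > 0" "coprime a c"
  shows "(LBINT \<theta>:{0..<1}. log_chord (real a * \<theta>) * log_chord (real c * \<theta>))
    = (LBINT \<theta>:{0..<1}. log_chord (real a * \<theta>) * log_chord \<theta>) / real c"
proof -
  let ?F = "\<lambda>\<theta>. log_chord (real a * \<theta>) * log_chord (real c * \<theta>)"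
  have sum: "(\<Sum>j<c. ?F ((u + real j) / real c)) = log_chord (real a * u) * log_chord u" if "u \<notin> \<rat>" for u
  proof -
    have "?F ((u + real j) / real c) = log_chord ((real a * u + real (a * j)) / real c) * log_chord u" for j
    proof -
      have "real c * ((u + real j) / real c) = u + real j"
        using \<open>c > 0\<close> by simp
      then show ?thesis
        using periodic_add_of_nat[of log_chord, OF log_chord_add_1, of u j]
        by (simp only:) (simp add: distrib_left)
    qed
    moreover have "real a * u \<notin> \<int>"
      using Rats_if_of_nat_mult_Ints assms(2) that by blast
    ultimately show ?thesis
      by (simp only: sum_distrib_right[symmetric]
          sum_log_chord_division_points_coprime[OF \<open>c > 0\<close> _ \<open>coprime a c\<close>] not_False_eq_True)
  qed
  have "(LBINT \<theta>:{0..<1}. ?F \<theta>) = (LBINT u:{0..<1}. (\<Sum>j<c. ?F ((u + real j) / real c))) / real c"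
    using assms by (intro set_integral_split_rescale set_integrable_log_chord_mult)
  also have "(LBINT u:{0..<1}. (\<Sum>j<c. ?F ((u + real j) / real c))) = (LBINT u:{0..<1}. log_chord (real a * u) * log_chord u)"
  proof (rule set_lebesgue_integral_cong_AE)
    show "AE u\<in>{0..<1} in lborel. (\<Sum>j<c. ?F ((u + real j) / real c)) = log_chord (real a * u) * log_chord u"
      using AE_irrational by eventually_elim (intro impI sum)
  qed measurable
  finally show ?thesis .
qed

text \<open>The common dilation by the gcd does not change the integral over a period; the coprime
  dilations left over are then removed one after the other.\<close>

lemma set_integral_log_chord_mult:
  assumes sq: "set_integrable lborel {0..<1} (\<lambda>\<theta>. (log_chord \<theta>)\<^sup>2)" and "a > 0" "c > 0"
  shows "(LBINT \<theta>:{0..<1}. log_chord (real a * \<theta>) * log_chord (real c * \<theta>))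
    = (real (gcd a c))\<^sup>2 / (real a * real c) * (LBINT \<theta>:{0..<1}. (log_chord \<theta>)\<^sup>2)"
proof -
  define g where "g = gcd a c"
  obtain a' c' where ac: "a = a' * g" "c = c' * g" "coprime a' c'"
    unfolding g_def using assms gcd_coprime_exists[of a c] by auto
  have pos: "g > 0" "a' > 0" "c' > 0"
    using ac assms by (auto intro!: Nat.gr0I)
  let ?h = "\<lambda>\<theta>. log_chord (real a' * \<theta>) * log_chord (real c' * \<theta>)"
  have per: "?h (x + 1) = ?h x" for x
    by (simp add: distrib_left periodic_add_of_nat[of log_chord, OF log_chord_add_1])
  have "(LBINT \<theta>:{0..<1}. log_chord (real a * \<theta>) * log_chord (real c * \<theta>)) = (LBINT \<theta>:{0..<1}. ?h (real g * \<theta>))"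
    by (simp add: ac mult.assoc)
  also have "\<dots> = (LBINT \<theta>:{0..<1}. ?h \<theta>)"
    using pos sq by (intro set_integral_periodic_rescale[of g ?h] per set_integrable_log_chord_mult)
  also have "\<dots> = (LBINT \<theta>:{0..<1}. log_chord (real a' * \<theta>) * log_chord \<theta>) / real c'"
    by (rule set_integral_log_chord_mult_coprime[OF sq pos(2,3) ac(3)])
  \<comment> \<open>The coprime case again, with the factors exchanged and the other dilation equal
    to 1.\<close>
  also have "(LBINT \<theta>:{0..<1}. log_chord (real a' * \<theta>) * log_chord \<theta>) = (LBINT \<theta>:{0..<1}. (log_chord \<theta>)\<^sup>2) / real a'"
    using set_integral_log_chord_mult_coprime[OF sq _ pos(2), of 1]
    by (simp add: mult.commute power2_eq_square)
  also have "\<dots> / real c' = (real (gcd a c))\<^sup>2 / (real a * real c) * (LBINT \<theta>:{0..<1}. (log_chord \<theta>)\<^sup>2)"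
    unfolding g_def[symmetric] using pos by (simp add: ac power2_eq_square)
  finally show ?thesis .
qed

section \<open>The mean square of the logarithmic chord\<close>

lemma Re_one_minus_pos:
  fixes z :: complex
  assumes "cmod z < 1"
  shows "Re (1 - z) > 0"
  using assms complex_Re_le_cmod[of z] by simp

text \<open>Cauchy's formula at the centre, where \<open>Ln 1 = 0\<close>. A radius below 1 keeps
  \<open>1 - z\<close> in the right half-plane, away from the branch cut.\<close>

lemma has_integral_Ln_circle_mean:
  assumes "0 < r" "r < 1"
  shows "((\<lambda>\<theta>. (Ln (1 - of_real r * cis (2 * pi * \<theta>)))\<^sup>2) has_integral 0) {0..1}"
proof -
  let ?f = "\<lambda>z. (Ln (1 - z))\<^sup>2"
  have slit: "1 - z \<notin> \<real>\<^sub>\<le>\<^sub>0" if "z \<in> cball 0 r" for z :: complex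
  proof -
    have "Re (1 - z) > 0"
      using that assms by (intro Re_one_minus_pos) simp
    then show ?thesis
      by (metis Re_complex_of_real complex_nonpos_Reals_iff not_less)
  qed
  have "((\<lambda>z. ?f z / (z - 0)) has_contour_integral (2 * of_real pi * \<i> * ?f 0)) (circlepath 0 r)"
  proof (rule Cauchy_integral_circlepath)
    show "continuous_on (cball 0 r) ?f"
      using slit by (intro continuous_intros) auto
    show "?f holomorphic_on ball 0 r"
      using slit by (intro holomorphic_intros) auto
  qed (use assms in simp)
  then have int: "((\<lambda>\<theta>. ?f (circlepath 0 r \<theta>) / circlepath 0 r \<theta> * vector_derivative (circlepath 0 r) (at \<theta> within {0..1}))
      has_integral 0) {0..1}"
    by (simp add: has_contour_integral_def)
  \<comment> \<open>On the circle \<open>dz / z\<close> becomes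
    \<open>2 \<pi> i d\<theta>\<close>.\<close>
  have eq: "?f (circlepath 0 r \<theta>) / circlepath 0 r \<theta> * vector_derivative (circlepath 0 r) (at \<theta> within {0..1})
      = 2 * of_real pi * \<i> * (Ln (1 - of_real r * cis (2 * pi * \<theta>)))\<^sup>2" if "\<theta> \<in> {0..1}" for \<theta>
  proof -
    have "circlepath 0 r \<theta> = of_real r * cis (2 * pi * \<theta>)"
      by (simp add: circlepath cis_conv_exp mult_ac)
    moreover have "vector_derivative (circlepath 0 r) (at \<theta> within {0..1}) = 2 * of_real pi * \<i> * (of_real r * cis (2 * pi * \<theta>))"
      using that by (subst vector_derivative_circlepath01) (auto simp: cis_conv_exp mult_ac)
    moreover have "of_real r * cis (2 * pi * \<theta>) \<noteq> 0"
      using assms by simp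
    ultimately show ?thesis
      by simp
  qed
  have "((\<lambda>\<theta>. 2 * of_real pi * \<i> * (Ln (1 - of_real r * cis (2 * pi * \<theta>)))\<^sup>2) has_integral 0) {0..1}"
    by (rule has_integral_eq[OF eq int])
  then have "((\<lambda>\<theta>. inverse (2 * of_real pi * \<i>) * (2 * of_real pi * \<i> * (Ln (1 - of_real r * cis (2 * pi * \<theta>)))\<^sup>2))
      has_integral inverse (2 * of_real pi * \<i>) * 0) {0..1}"
    by (rule has_integral_mult_right)
  moreover have "inverse (2 * of_real pi * \<i>) * (2 * of_real pi * \<i> * x) = x" for x :: complex
    by (simp add: field_simps)
  ultimately show ?thesis
    by (simp only: mult_zero_right)
qed

text \<open>For \<open>0 < \<theta> < 1\<close> the sine is positive, so this is the polar form and
  the argument can be read off.\<close>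

lemma one_minus_cis_polar:
  "1 - cis (2 * pi * \<theta>) = of_real (2 * sin (pi * \<theta>)) * cis (pi * (\<theta> - 1 / 2))"
proof -
  have "cis (2 * pi * \<theta>) = Complex (1 - 2 * (sin (pi * \<theta>))\<^sup>2) (2 * sin (pi * \<theta>) * cos (pi * \<theta>))"
    using cos_double_sin[of "pi * \<theta>"] sin_double[of "pi * \<theta>"] by (simp add: complex_eq_iff mult.assoc)
  moreover have "cos (pi * (\<theta> - 1 / 2)) = sin (pi * \<theta>)" "sin (pi * (\<theta> - 1 / 2)) = - cos (pi * \<theta>)"
    by (simp_all add: right_diff_distrib cos_diff sin_diff)
  ultimately show ?thesis
    by (simp add: complex_eq_iff power2_eq_square)
qed

lemma Im_Ln_one_minus_cis:
  assumes "0 < \<theta>" "\<theta> < 1"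
  shows "Im (Ln (1 - cis (2 * pi * \<theta>))) = pi * (\<theta> - 1 / 2)"
proof -
  have s: "2 * sin (pi * \<theta>) > 0"
    using assms by (simp add: sin_gt_zero)
  have "Ln (1 - cis (2 * pi * \<theta>)) = Complex (ln (2 * sin (pi * \<theta>))) (pi * (\<theta> - 1 / 2))"
  proof (rule Ln_unique)
    show "exp (Complex (ln (2 * sin (pi * \<theta>))) (pi * (\<theta> - 1 / 2))) = 1 - cis (2 * pi * \<theta>)"
      unfolding one_minus_cis_polar using s by (simp add: exp_eq_polar)
    have "pi * (-1) < pi * (\<theta> - 1 / 2)" "pi * (\<theta> - 1 / 2) \<le> pi * 1"
      using assms by (intro mult_strict_left_mono mult_left_mono; simp)+
    then show "- pi < Im (Complex (ln (2 * sin (pi * \<theta>))) (pi * (\<theta> - 1 / 2)))"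
      "Im (Complex (ln (2 * sin (pi * \<theta>))) (pi * (\<theta> - 1 / 2))) \<le> pi"
      by simp_all
  qed
  then show ?thesis by simp
qed

text \<open>The mean value property is applied on circles of radius \<open>r k < 1\<close>, and the
  radius then tends to 1. The imaginary parts are bounded, which controls the real parts in mean
  square.\<close>

lemma set_integral_log_chord_square:
  "set_integrable lborel {0..1} (\<lambda>\<theta>. (log_chord \<theta>)\<^sup>2)"
  "(LBINT \<theta>:{0..1}. (log_chord \<theta>)\<^sup>2) = pi\<^sup>2 / 12"
proof -
  \<comment> \<open>The shift by 2 keeps every radius strictly between 0 and 1.\<close>
  define r where "r k = 1 - 1 / real (k + 2)" for k :: nat
  have r: "0 < r k" "r k < 1" for k
    by (auto simp: r_def)
  have r_lim: "r \<longlonglongrightarrow> 1"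
    unfolding r_def by real_asymp
  define L where "L k \<theta> = Ln (1 - of_real (r k) * cis (2 * pi * \<theta>))" for k \<theta>
  have re_pos: "Re (1 - of_real (r k) * cis (2 * pi * \<theta>)) > 0" for k \<theta>
    using r[of k] by (intro Re_one_minus_pos) (simp add: norm_mult)
  have nz: "1 - of_real (r k) * cis (2 * pi * \<theta>) \<noteq> 0" for k \<theta>
    using re_pos[of k \<theta>] by (metis less_irrefl zero_complex.sel(1))
  have slit: "1 - of_real (r k) * cis (2 * pi * \<theta>) \<notin> \<real>\<^sub>\<le>\<^sub>0" for k \<theta>
    using re_pos[of k \<theta>] unfolding complex_nonpos_Reals_iff by linarith
  have contL: "continuous_on UNIV (L k)" for k
    unfolding L_def using slit by (intro continuous_intros) auto
  have ReL: "Re (L k \<theta>) = ln (cmod (1 - of_real (r k) * cis (2 * pi * \<theta>)))" for k \<theta>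
    unfolding L_def using nz by simp
  have ImL: "\<bar>Im (L k \<theta>)\<bar> \<le> pi / 2" for k \<theta>
    unfolding L_def using Re_Ln_pos_lt_imp[OF re_pos[of k \<theta>]] by simp
  have cont_int: "set_integrable lborel {0..1} g" if "continuous_on UNIV g" for g :: "real \<Rightarrow> 'b :: {banach, second_countable_topology}"
    using that by (intro borel_integrable_atLeastAtMost') (auto intro: continuous_on_subset)
  have ReL_int: "set_integrable lborel {0..1} (\<lambda>\<theta>. (Re (L k \<theta>))\<^sup>2)" for k
    by (intro cont_int continuous_intros contL)
  have ImL_int: "set_integrable lborel {0..1} (\<lambda>\<theta>. (Im (L k \<theta>))\<^sup>2)" for k
    by (intro cont_int continuous_intros contL)
  \<comment> \<open>The real part of the mean value property: \<open>Re (w\<^sup>2) = (Re w)\<^sup>2 - (Im w)\<^sup>2\<close>.\<close>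
  have mean: "(LBINT \<theta>:{0..1}. (Re (L k \<theta>))\<^sup>2) = (LBINT \<theta>:{0..1}. (Im (L k \<theta>))\<^sup>2)" for k
  proof -
    have "((\<lambda>\<theta>. Re ((L k \<theta>)\<^sup>2)) has_integral Re 0) {0..1}"
      using has_integral_Re[OF has_integral_Ln_circle_mean[OF r]] unfolding L_def .
    then have "((\<lambda>\<theta>. (Re (L k \<theta>))\<^sup>2 - (Im (L k \<theta>))\<^sup>2) has_integral 0) {0..1}"
      by (simp add: power2_eq_square)
    then have "integral {0..1} (\<lambda>\<theta>. (Re (L k \<theta>))\<^sup>2 - (Im (L k \<theta>))\<^sup>2) = 0"
      by (rule integral_unique)
    then have "(LBINT \<theta>:{0..1}. (Re (L k \<theta>))\<^sup>2 - (Im (L k \<theta>))\<^sup>2) = 0"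
      using set_borel_integral_eq_integral(2)[OF set_integral_diff(1)[OF ReL_int ImL_int]] by simp
    then show ?thesis
      using set_integral_diff(2)[OF ReL_int ImL_int] by simp
  qed
  have L_lim: "(\<lambda>k. L k \<theta>) \<longlonglongrightarrow> Ln (1 - cis (2 * pi * \<theta>))" if "0 < \<theta>" "\<theta> < 1" for \<theta>
  proof -
    have "sin (pi * \<theta>) > 0"
      using that by (simp add: sin_gt_zero)
    then have "cos (2 * pi * \<theta>) < 1"
      using cos_double_sin[of "pi * \<theta>"] by (simp add: mult.assoc)
    then have "1 - of_real 1 * cis (2 * pi * \<theta>) \<notin> \<real>\<^sub>\<le>\<^sub>0"
      unfolding complex_nonpos_Reals_iff by simp
    then have "(\<lambda>k. L k \<theta>) \<longlonglongrightarrow> Ln (1 - of_real 1 * cis (2 * pi * \<theta>))"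
      unfolding L_def by (intro tendsto_intros r_lim)
    then show ?thesis by simp
  qed
  have ReLn: "Re (Ln (1 - cis (2 * pi * \<theta>))) = log_chord \<theta>" if "0 < \<theta>" "\<theta> < 1" for \<theta>
  proof -
    have "2 * sin (pi * \<theta>) > 0"
      using that by (simp add: sin_gt_zero)
    then have "1 - cis (2 * pi * \<theta>) \<noteq> 0"
      unfolding one_minus_cis_polar by simp
    then show ?thesis
      by (simp add: log_chord_def)
  qed
  have inner: "AE \<theta> in lborel. \<theta> \<noteq> 0 \<and> \<theta> \<noteq> (1::real)"
    using AE_lborel_singleton[of "0::real"] AE_lborel_singleton[of "1::real"] by eventually_elim simp
  have re_lim: "AE \<theta> in lborel. (\<lambda>k. indicator {0..1} \<theta> *\<^sub>R (Re (L k \<theta>))\<^sup>2) \<longlonglongrightarrow> indicator {0..1} \<theta> *\<^sub>R (log_chord \<theta>)\<^sup>2"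
    using inner
  proof eventually_elim
    case (elim \<theta>)
    show ?case
    proof (cases "\<theta> \<in> {0..1}")
      case True
      then have \<theta>: "0 < \<theta>" "\<theta> < 1" using elim by auto
      show ?thesis
        using tendsto_power[OF tendsto_Re[OF L_lim[OF \<theta>]], of 2] True by (simp add: ReLn[OF \<theta>])
    qed simp
  qed
  have im_lim: "AE \<theta> in lborel. (\<lambda>k. indicator {0..1} \<theta> *\<^sub>R (Im (L k \<theta>))\<^sup>2) \<longlonglongrightarrow> indicator {0..1} \<theta> *\<^sub>R (pi * (\<theta> - 1 / 2))\<^sup>2"
    using inner
  proof eventually_elim
    case (elim \<theta>)
    show ?case
    proof (cases "\<theta> \<in> {0..1}")
      case True
      then have \<theta>: "0 < \<theta>" "\<theta> < 1" using elim by auto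
      show ?thesis
        using tendsto_power[OF tendsto_Im[OF L_lim[OF \<theta>]], of 2] True by (simp only: Im_Ln_one_minus_cis[OF \<theta>]) simp
    qed simp
  qed
  have [measurable]: "L k \<in> borel_measurable borel" for k
    using contL by (rule borel_measurable_continuous_onI)
  have const_int: "set_integrable lborel {0..1::real} (\<lambda>\<theta>. c)" for c :: real
    by (intro cont_int continuous_intros)
  have ImL_sq: "(Im (L k \<theta>))\<^sup>2 \<le> (pi / 2)\<^sup>2" for k \<theta>
    using power_mono[OF ImL[of k \<theta>], of 2] by simp
  have "(LBINT \<theta>:{0..1}. (Im (L k \<theta>))\<^sup>2) \<le> (LBINT \<theta>:{0..1::real}. (pi / 2)\<^sup>2)" for k
    by (intro set_integral_mono ImL_int const_int ImL_sq)
  then have bound: "(LBINT \<theta>:{0..1}. (Re (L k \<theta>))\<^sup>2) \<le> (pi / 2)\<^sup>2" for k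
    unfolding mean by (simp add: set_lebesgue_integral_def)
  \<comment> \<open>Fatou's lemma: the squares of the real parts converge almost everywhere, and
    their integrals are at most \<open>(pi / 2)\<^sup>2\<close> by \<open>bound\<close>.\<close>
  show sq_int: "set_integrable lborel {0..1} (\<lambda>\<theta>. (log_chord \<theta>)\<^sup>2)"
    unfolding set_integrable_def integrable_iff_bounded
  proof
    have "(\<integral>\<^sup>+ \<theta>. ennreal (norm (indicator {0..1} \<theta> *\<^sub>R (log_chord \<theta>)\<^sup>2)) \<partial>lborel)
      = (\<integral>\<^sup>+ \<theta>. liminf (\<lambda>k. ennreal (indicator {0..1} \<theta> *\<^sub>R (Re (L k \<theta>))\<^sup>2)) \<partial>lborel)"
    proof (rule nn_integral_cong_AE)
      show "AE \<theta> in lborel. ennreal (norm (indicator {0..1} \<theta> *\<^sub>R (log_chord \<theta>)\<^sup>2))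
          = liminf (\<lambda>k. ennreal (indicator {0..1} \<theta> *\<^sub>R (Re (L k \<theta>))\<^sup>2))"
        using re_lim
      proof eventually_elim
        case (elim \<theta>)
        have "liminf (\<lambda>k. ennreal (indicator {0..1} \<theta> *\<^sub>R (Re (L k \<theta>))\<^sup>2)) = ennreal (indicator {0..1} \<theta> *\<^sub>R (log_chord \<theta>)\<^sup>2)"
          by (intro lim_imp_Liminf tendsto_ennrealI elim) simp
        then show ?case by simp
      qed
    qed
    also have "\<dots> \<le> liminf (\<lambda>k. \<integral>\<^sup>+ \<theta>. ennreal (indicator {0..1} \<theta> *\<^sub>R (Re (L k \<theta>))\<^sup>2) \<partial>lborel)"
      by (rule nn_integral_liminf) measurable
    also have "\<dots> \<le> liminf (\<lambda>k::nat. ennreal ((pi / 2)\<^sup>2))"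
    proof (intro Liminf_mono always_eventually allI)
      fix k
      have "(\<integral>\<^sup>+ \<theta>. ennreal (indicator {0..1} \<theta> *\<^sub>R (Re (L k \<theta>))\<^sup>2) \<partial>lborel) = ennreal (LBINT \<theta>:{0..1}. (Re (L k \<theta>))\<^sup>2)"
        using ReL_int[of k] unfolding set_integrable_def set_lebesgue_integral_def
        by (intro nn_integral_eq_integral) auto
      also have "\<dots> \<le> ennreal ((pi / 2)\<^sup>2)"
        by (intro ennreal_leI bound)
      finally show "(\<integral>\<^sup>+ \<theta>. ennreal (indicator {0..1} \<theta> *\<^sub>R (Re (L k \<theta>))\<^sup>2) \<partial>lborel) \<le> ennreal ((pi / 2)\<^sup>2)" .
    qed
    also have "\<dots> < \<infinity>"
      by (simp add: Liminf_const)
    finally show "(\<integral>\<^sup>+ \<theta>. ennreal (norm (indicator {0..1} \<theta> *\<^sub>R (log_chord \<theta>)\<^sup>2)) \<partial>lborel) < \<infinity>" .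
  qed measurable
  \<comment> \<open>A majorant independent of \<open>k\<close>: both \<open>1 - r k\<close> and
    \<open>S - (1 - r k)\<close> are at most \<open>R\<close>, so \<open>S \<le> 2 * R\<close>,
    while \<open>R \<le> 2\<close>. Hence \<open>ln R\<close> differs from the range of
    \<open>ln S\<close> only by multiples of \<open>ln 2\<close>; the factor 8 is twice the square
    of 2.\<close>
  have dom: "(Re (L k \<theta>))\<^sup>2 \<le> 8 * (ln 2)\<^sup>2 + 2 * (log_chord \<theta>)\<^sup>2" if "0 < \<theta>" "\<theta> < 1" for k \<theta>
  proof -
    define w where "w = cis (2 * pi * \<theta>)"
    define R where "R = cmod (1 - of_real (r k) * w)"
    define S where "S = cmod (1 - w)"
    have "S > 0"
    proof -
      have "2 * sin (pi * \<theta>) > 0"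
        using that by (simp add: sin_gt_zero)
      then show ?thesis
        unfolding S_def w_def one_minus_cis_polar by simp
    qed
    have "R > 0" unfolding R_def w_def using nz by simp
    have w: "cmod w = 1" by (simp add: w_def)
    have "R \<le> 2"
      unfolding R_def using norm_triangle_ineq4[of 1 "of_real (r k) * w"] r[of k] by (simp add: norm_mult w)
    have "1 - r k \<le> R"
      unfolding R_def using norm_triangle_ineq2[of 1 "of_real (r k) * w"] r[of k] by (simp add: norm_mult w)
    moreover have "S \<le> R + (1 - r k)"
    proof -
      have "1 - w = (1 - of_real (r k) * w) - of_real (1 - r k) * w"
        by (simp add: algebra_simps)
      then have "S \<le> R + cmod (of_real (1 - r k) * w)"
        unfolding S_def R_def by (metis norm_triangle_ineq4)
      also have "cmod (of_real (1 - r k) * w) = 1 - r k"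
        unfolding norm_mult w norm_of_real using r[of k] by simp
      finally show ?thesis .
    qed
    ultimately have "S \<le> 2 * R" by linarith
    then have "ln S \<le> ln (2 * R)"
      using \<open>S > 0\<close> \<open>R > 0\<close> by simp
    then have "ln S \<le> ln 2 + ln R"
      using \<open>R > 0\<close> by (simp add: ln_mult)
    moreover have "ln R \<le> ln 2"
      using \<open>R \<le> 2\<close> \<open>R > 0\<close> by simp
    moreover have "ln (2::real) > 0" by simp
    ultimately have "\<bar>ln R\<bar> \<le> 2 * ln 2 + \<bar>ln S\<bar>" by linarith
    then have "(ln R)\<^sup>2 \<le> (2 * ln 2 + \<bar>ln S\<bar>)\<^sup>2"
      using power_mono[of "\<bar>ln R\<bar>" "2 * ln 2 + \<bar>ln S\<bar>" 2] by simp
    also have "\<dots> \<le> 8 * (ln 2)\<^sup>2 + 2 * (ln S)\<^sup>2"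
      using sum_squares_bound[of "2 * ln 2" "\<bar>ln S\<bar>"] by (simp add: power2_sum power_mult_distrib)
    finally show ?thesis
      unfolding ReL R_def S_def w_def log_chord_def .
  qed
  have "(\<lambda>k. LBINT \<theta>:{0..1}. (Re (L k \<theta>))\<^sup>2) \<longlonglongrightarrow> (LBINT \<theta>:{0..1}. (log_chord \<theta>)\<^sup>2)"
    unfolding set_lebesgue_integral_def
  proof (rule integral_dominated_convergence[where w = "\<lambda>\<theta>. indicator {0..1} \<theta> *\<^sub>R (8 * (ln 2)\<^sup>2 + 2 * (log_chord \<theta>)\<^sup>2)"])
    show "integrable lborel (\<lambda>\<theta>. indicator {0..1} \<theta> *\<^sub>R (8 * (ln 2)\<^sup>2 + 2 * (log_chord \<theta>)\<^sup>2))"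
      unfolding set_integrable_def[symmetric]
      by (intro set_integral_add(1) const_int set_integrable_mult_right sq_int)
    show "AE \<theta> in lborel. norm (indicator {0..1} \<theta> *\<^sub>R (Re (L k \<theta>))\<^sup>2)
        \<le> indicator {0..1} \<theta> *\<^sub>R (8 * (ln 2)\<^sup>2 + 2 * (log_chord \<theta>)\<^sup>2)" for k
      using inner
    proof eventually_elim
      case (elim \<theta>)
      then show ?case
        using dom[of \<theta> k] by (cases "\<theta> \<in> {0..1}") auto
    qed
  qed (use re_lim in measurable)
  moreover have "(\<lambda>k. LBINT \<theta>:{0..1}. (Im (L k \<theta>))\<^sup>2) \<longlonglongrightarrow> (LBINT \<theta>:{0..1}. (pi * (\<theta> - 1 / 2))\<^sup>2)"
    unfolding set_lebesgue_integral_def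
  proof (rule integral_dominated_convergence[where w = "\<lambda>\<theta>. indicator {0..1} \<theta> *\<^sub>R (pi / 2)\<^sup>2"])
    show "integrable lborel (\<lambda>\<theta>::real. indicator {0..1} \<theta> *\<^sub>R (pi / 2)\<^sup>2)"
      unfolding set_integrable_def[symmetric] by (rule const_int)
    show "AE \<theta> in lborel. norm (indicator {0..1} \<theta> *\<^sub>R (Im (L k \<theta>))\<^sup>2) \<le> indicator {0..1} \<theta> *\<^sub>R (pi / 2)\<^sup>2" for k
      using ImL_sq[of k] by (auto simp: indicator_def)
  qed (use im_lim in measurable)
  ultimately have "(LBINT \<theta>:{0..1}. (log_chord \<theta>)\<^sup>2) = (LBINT \<theta>:{0..1}. (pi * (\<theta> - 1 / 2))\<^sup>2)"
    unfolding mean using LIMSEQ_unique by blast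
  also have "\<dots> = integral {0..1} (\<lambda>\<theta>. (pi * (\<theta> - 1 / 2))\<^sup>2)"
    by (intro set_borel_integral_eq_integral(2) cont_int continuous_intros)
  also have "\<dots> = pi\<^sup>2 / 12"
  proof -
    have "((\<lambda>\<theta>. (pi * (\<theta> - 1 / 2))\<^sup>2) has_integral (pi\<^sup>2 * (1 - 1 / 2) ^ 3 / 3 - pi\<^sup>2 * (0 - 1 / 2) ^ 3 / 3)) {0..1}"
    proof (rule fundamental_theorem_of_calculus[where f = "\<lambda>\<theta>. pi\<^sup>2 * (\<theta> - 1 / 2) ^ 3 / 3"])
      fix x :: real
      have "((\<lambda>\<theta>. pi\<^sup>2 * (\<theta> - 1 / 2) ^ 3 / 3) has_real_derivative (pi * (x - 1 / 2))\<^sup>2) (at x within {0..1})"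
        by (rule derivative_eq_intros refl)+ (simp_all add: power_mult_distrib)
      then show "((\<lambda>\<theta>. pi\<^sup>2 * (\<theta> - 1 / 2) ^ 3 / 3) has_vector_derivative (pi * (x - 1 / 2))\<^sup>2) (at x within {0..1})"
        by (simp add: has_real_derivative_iff_has_vector_derivative)
    qed simp
    then show ?thesis
      by (simp add: integral_unique power3_eq_cube)
  qed
  finally show "(LBINT \<theta>:{0..1}. (log_chord \<theta>)\<^sup>2) = pi\<^sup>2 / 12" .
qed

section \<open>Products of cyclotomic polynomials\<close>

lemma finite_primitive_roots_of_unity:
  assumes "n > 0"
  shows "finite (primitive_roots_of_unity n)"
  by (rule finite_subset[OF _ finite_roots_unity[of n]]) (use assms in \<open>auto simp: primitive_roots_of_unity_def\<close>)

text \<open>Roots of unity are sorted by their order, the least positive exponent giving 1, which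
  divides \<open>n\<close> by division with remainder.\<close>

lemma roots_of_unity_eq_Union_primitive:
  assumes "n > 0"
  shows "{z. z ^ n = 1} = (\<Union>d\<in>{d. d dvd n}. primitive_roots_of_unity d)"
proof (intro Set.equalityI subsetI)
  fix z :: complex assume "z \<in> {z. z ^ n = 1}"
  then have zn: "z ^ n = 1" by simp
  define d where "d = (LEAST d. 0 < d \<and> z ^ d = 1)"
  have d: "0 < d" "z ^ d = 1"
    unfolding d_def using LeastI[of "\<lambda>d. 0 < d \<and> z ^ d = 1" n] assms zn by auto
  have least: "z ^ m \<noteq> 1" if "0 < m" "m < d" for m
    using not_less_Least[of m "\<lambda>d. 0 < d \<and> z ^ d = 1"] that unfolding d_def by auto
  have "z ^ n = (z ^ d) ^ (n div d) * z ^ (n mod d)"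
    by (metis mult_div_mod_eq power_add power_mult)
  then have "z ^ (n mod d) = 1"
    using d zn by simp
  then have "n mod d = 0"
    using least[of "n mod d"] d by (meson gr0I mod_less_divisor)
  then show "z \<in> (\<Union>d\<in>{d. d dvd n}. primitive_roots_of_unity d)"
    using d least by (auto simp: primitive_roots_of_unity_def)
next
  fix z assume "z \<in> (\<Union>d\<in>{d. d dvd n}. primitive_roots_of_unity d)"
  then show "z \<in> {z. z ^ n = 1}"
    by (auto simp: primitive_roots_of_unity_def power_mult elim!: dvdE)
qed

lemma disjoint_primitive_roots_of_unity:
  assumes "d > 0" "e > 0" "d \<noteq> e"
  shows "primitive_roots_of_unity d \<inter> primitive_roots_of_unity e = {}"
  using assms by (auto simp: primitive_roots_of_unity_def) (metis linorder_neqE_nat)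

lemma power_minus_1_eq_prod_cyclotomic:
  assumes "n > 0"
  shows "y ^ n - 1 = (\<Prod>d | d dvd n. poly (cyclotomic_poly d) y)"
proof -
  have pos: "d > 0" if "d dvd n" for d
    using that assms by (auto intro: Nat.gr0I)
  have "y ^ n - 1 = (\<Prod>d\<in>{d. d dvd n}. \<Prod>z\<in>primitive_roots_of_unity d. y - z)"
    unfolding power_minus_1_eq_prod_roots[OF assms] roots_of_unity_eq_Union_primitive[OF assms]
    using assms pos by (intro prod.UNION_disjoint)
      (auto simp: finite_primitive_roots_of_unity disjoint_primitive_roots_of_unity)
  then show ?thesis
    by (simp add: cyclotomic_poly_def poly_prod)
qed

text \<open>
  Irrational arguments avoid all roots of unity, where \<open>ln 0 = 0\<close> would break additivity.
\<close>

definition log_chord_span :: "(real \<Rightarrow> real) \<Rightarrow> bool" where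
  "log_chord_span g \<longleftrightarrow> (\<exists>(N::nat) (b :: nat \<Rightarrow> int). (\<forall>a>N. b a = 0) \<and>
     (\<forall>\<theta>. \<theta> \<notin> \<rat> \<longrightarrow> g \<theta> = (\<Sum>a=1..N. of_int (b a) * log_chord (real a * \<theta>))))"

lemma log_chord_span_cong:
  assumes "log_chord_span f" "\<And>\<theta>. \<theta> \<notin> \<rat> \<Longrightarrow> g \<theta> = f \<theta>"
  shows "log_chord_span g"
  using assms unfolding log_chord_span_def by simp

lemma log_chord_span_0: "log_chord_span (\<lambda>\<theta>. 0)"
  unfolding log_chord_span_def by (intro exI[of _ 0] exI[of _ "\<lambda>_. 0"]) simp

text \<open>Since coefficients vanish beyond the cutoff, both combinations can be padded to a common
  length and subtracted termwise.\<close>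

lemma log_chord_span_diff:
  assumes "log_chord_span f" "log_chord_span g"
  shows "log_chord_span (\<lambda>\<theta>. f \<theta> - g \<theta>)"
proof -
  obtain N b where b: "\<forall>a>N. b a = 0"
    "\<forall>\<theta>. \<theta> \<notin> \<rat> \<longrightarrow> f \<theta> = (\<Sum>a=1..N. of_int (b a :: int) * log_chord (real a * \<theta>))"
    using assms(1) unfolding log_chord_span_def by blast
  obtain M c where c: "\<forall>a>M. c a = 0"
    "\<forall>\<theta>. \<theta> \<notin> \<rat> \<longrightarrow> g \<theta> = (\<Sum>a=1..M. of_int (c a :: int) * log_chord (real a * \<theta>))"
    using assms(2) unfolding log_chord_span_def by blast
  define K where "K = max N M"
  have "(\<Sum>a=1..N. of_int (b a) * log_chord (real a * \<theta>)) = (\<Sum>a=1..K. of_int (b a) * log_chord (real a * \<theta>))" for \<theta>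
    using b(1) by (intro sum.mono_neutral_left) (auto simp: K_def)
  moreover have "(\<Sum>a=1..M. of_int (c a) * log_chord (real a * \<theta>)) = (\<Sum>a=1..K. of_int (c a) * log_chord (real a * \<theta>))" for \<theta>
    using c(1) by (intro sum.mono_neutral_left) (auto simp: K_def)
  ultimately show ?thesis
    unfolding log_chord_span_def using b c
    by (intro exI[of _ K] exI[of _ "\<lambda>a. b a - c a"])
      (auto simp: K_def left_diff_distrib sum_subtractf)
qed

lemma log_chord_span_add:
  assumes "log_chord_span f" "log_chord_span g"
  shows "log_chord_span (\<lambda>\<theta>. f \<theta> + g \<theta>)"
  using log_chord_span_diff[OF assms(1) log_chord_span_diff[OF log_chord_span_0 assms(2)]] by simp

lemma log_chord_span_sum:
  assumes "finite A" "\<And>x. x \<in> A \<Longrightarrow> log_chord_span (f x)"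
  shows "log_chord_span (\<lambda>\<theta>. \<Sum>x\<in>A. f x \<theta>)"
  using assms by (induction A rule: finite_induct) (auto intro: log_chord_span_0 log_chord_span_add)

lemma log_chord_span_rescale:
  assumes "n > 0"
  shows "log_chord_span (\<lambda>\<theta>. log_chord (real n * \<theta>))"
  unfolding log_chord_span_def
proof (intro exI[of _ n] exI[of _ "\<lambda>a. if a = n then 1 else 0"] conjI allI impI)
  fix \<theta> :: real
  have "(\<Sum>a=1..n. of_int (if a = n then 1 else 0) * log_chord (real a * \<theta>))
    = (\<Sum>a\<in>{1..n}. if a = n then log_chord (real a * \<theta>) else 0)"
    by (intro sum.cong) auto
  then show "log_chord (real n * \<theta>) = (\<Sum>a=1..n. of_int (if a = n then 1 else 0) * log_chord (real a * \<theta>))"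
    using assms by simp
qed simp

lemma cis_irrational_power_neq_1:
  assumes "\<theta> \<notin> \<rat>" "n > 0"
  shows "cis (2 * pi * \<theta>) ^ n \<noteq> 1"
proof
  assume "cis (2 * pi * \<theta>) ^ n = 1"
  then have "cis (2 * pi * (real n * \<theta>)) = 1"
    by (simp add: Complex.DeMoivre mult_ac)
  then show False
    using cis_eq_1_imp_Ints Rats_if_of_nat_mult_Ints assms by blast
qed

lemma cyclotomic_poly_irrational_neq_0:
  assumes "\<theta> \<notin> \<rat>" "n > 0"
  shows "poly (cyclotomic_poly n) (cis (2 * pi * \<theta>)) \<noteq> 0"
  using cis_irrational_power_neq_1[OF assms] finite_primitive_roots_of_unity[OF assms(2)]
  by (auto simp: cyclotomic_poly_def poly_prod primitive_roots_of_unity_def)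

text \<open>Strong induction takes the place of Moebius inversion: in the logarithm of the
  factorisation of \<open>x ^ n - 1\<close>, the terms of the proper divisors are already known and
  are subtracted.\<close>

lemma log_chord_span_cyclotomic:
  assumes "n > 0"
  shows "log_chord_span (\<lambda>\<theta>. ln (cmod (poly (cyclotomic_poly n) (cis (2 * pi * \<theta>)))))"
  using assms
proof (induction n rule: less_induct)
  case (less n)
  let ?l = "\<lambda>d \<theta>. ln (cmod (poly (cyclotomic_poly d) (cis (2 * pi * \<theta>))))"
  define A where "A = {d. d dvd n} - {n}"
  have A: "d > 0 \<and> d < n" if "d \<in> A" for d
    using that less.prems dvd_imp_le[of d n] by (auto simp: A_def intro: Nat.gr0I)
  have fin: "finite {d. d dvd n}"
    using less.prems by simp
  have "?l n \<theta> = log_chord (real n * \<theta>) - (\<Sum>d\<in>A. ?l d \<theta>)" if "\<theta> \<notin> \<rat>" for \<theta>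
  proof -
    have "cis (2 * pi * (real n * \<theta>)) - 1 = (\<Prod>d | d dvd n. poly (cyclotomic_poly d) (cis (2 * pi * \<theta>)))"
      using power_minus_1_eq_prod_cyclotomic[OF less.prems, of "cis (2 * pi * \<theta>)"]
      by (simp add: Complex.DeMoivre mult_ac)
    then have "log_chord (real n * \<theta>) = ln (\<Prod>d | d dvd n. cmod (poly (cyclotomic_poly d) (cis (2 * pi * \<theta>))))"
      unfolding log_chord_def prod_norm by (metis norm_minus_commute)
    also have "\<dots> = (\<Sum>d | d dvd n. ?l d \<theta>)"
    proof (rule ln_prod)
      fix d assume "d \<in> {d. d dvd n}"
      then have "d > 0" using less.prems by (auto intro: Nat.gr0I)
      then show "cmod (poly (cyclotomic_poly d) (cis (2 * pi * \<theta>))) \<noteq> 0"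
        using cyclotomic_poly_irrational_neq_0[OF that] by simp
    qed (rule fin)
    also have "\<dots> = ?l n \<theta> + (\<Sum>d\<in>A. ?l d \<theta>)"
      unfolding A_def using fin by (intro sum.remove) auto
    finally show ?thesis by simp
  qed
  moreover have "log_chord_span (\<lambda>\<theta>. log_chord (real n * \<theta>) - (\<Sum>d\<in>A. ?l d \<theta>))"
    using A less fin by (intro log_chord_span_diff log_chord_span_rescale log_chord_span_sum) (auto simp: A_def)
  ultimately show ?case
    by (rule log_chord_span_cong[rotated])
qed

text \<open>Nonvanishing is carried along because \<open>ln\<close> is additive only on nonzero
  factors. Monomials have modulus 1 on the circle and contribute nothing.\<close>

lemma log_chord_span_prod_list:
  assumes "\<forall>Q\<in>set Qs. (\<exists>n>0. Q = cyclotomic_poly n) \<or> (\<exists>k. Q = monom 1 k)"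
  shows "log_chord_span (\<lambda>\<theta>. ln (cmod (poly (prod_list Qs) (cis (2 * pi * \<theta>)))))
    \<and> (\<forall>\<theta>. \<theta> \<notin> \<rat> \<longrightarrow> poly (prod_list Qs) (cis (2 * pi * \<theta>)) \<noteq> 0)"
  using assms
proof (induction Qs)
  case Nil
  then show ?case by (simp add: log_chord_span_0)
next
  case (Cons Q Qs)
  have Q: "log_chord_span (\<lambda>\<theta>. ln (cmod (poly Q (cis (2 * pi * \<theta>)))))
    \<and> (\<forall>\<theta>. \<theta> \<notin> \<rat> \<longrightarrow> poly Q (cis (2 * pi * \<theta>)) \<noteq> 0)"
    using Cons.prems log_chord_span_cyclotomic cyclotomic_poly_irrational_neq_0
    by (auto simp: poly_monom norm_power log_chord_span_0)
  have IH: "log_chord_span (\<lambda>\<theta>. ln (cmod (poly (prod_list Qs) (cis (2 * pi * \<theta>)))))"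
    "\<forall>\<theta>. \<theta> \<notin> \<rat> \<longrightarrow> poly (prod_list Qs) (cis (2 * pi * \<theta>)) \<noteq> 0"
    using Cons by auto
  have "log_chord_span (\<lambda>\<theta>. ln (cmod (poly (prod_list (Q # Qs)) (cis (2 * pi * \<theta>)))))"
    by (rule log_chord_span_cong[OF log_chord_span_add[OF conjunct1[OF Q] IH(1)]])
      (use Q IH in \<open>simp add: norm_mult ln_mult\<close>)
  then show ?case
    using Q IH by simp
qed

section \<open>Roots on the circle and nonvanishing of the coefficient vector\<close>

lemma prod_list_monom:
  assumes "\<forall>Q\<in>set Qs. \<exists>k. Q = monom (1::complex) k"
  shows "\<exists>k. prod_list Qs = monom 1 k"
  using assms
proof (induction Qs)
  case Nil
  then show ?case by (auto intro!: exI[of _ 0] simp: monom_0 one_pCons)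
next
  case (Cons Q Qs)
  then obtain k l where "Q = monom 1 k" "prod_list Qs = monom 1 l" by auto
  then show ?case by (auto simp: mult_monom)
qed

lemma cyclotomic_poly_root:
  assumes "n > 0"
  shows "poly (cyclotomic_poly n) (cis (2 * pi * (1 / real n))) = 0"
proof -
  let ?z = "cis (2 * pi * (1 / real n))"
  have pow: "?z ^ m = cis (2 * pi * (real m / real n))" for m
    by (simp add: Complex.DeMoivre mult_ac)
  have "?z ^ m \<noteq> 1" if m: "0 < m" "m < n" for m
  proof
    assume "?z ^ m = 1"
    then have "real m / real n \<in> \<int>"
      using pow cis_eq_1_imp_Ints by simp
    moreover have "0 < real m / real n" "real m / real n < 1"
      using m by auto
    ultimately show False
      by (auto elim!: Ints_cases)
  qed
  moreover have "?z ^ n = 1"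
    unfolding pow using assms by simp
  ultimately have "?z \<in> primitive_roots_of_unity n"
    by (simp add: primitive_roots_of_unity_def)
  then show ?thesis
    using finite_primitive_roots_of_unity[OF assms] by (auto simp: cyclotomic_poly_def poly_prod)
qed

text \<open>A modulus equal to 1 at all irrational arguments would, by continuity, be 1 at the root
  as well.\<close>

lemma not_unimodular_if_root_on_circle:
  assumes "q \<in> \<rat>" "poly P (cis (2 * pi * q)) = 0"
  shows "\<exists>\<theta>. \<theta> \<notin> \<rat> \<and> cmod (poly P (cis (2 * pi * \<theta>))) \<noteq> 1"
proof (rule ccontr)
  assume "\<not> ?thesis"
  then have one: "cmod (poly P (cis (2 * pi * \<theta>))) = 1" if "\<theta> \<notin> \<rat>" for \<theta>
    using that by blast
  obtain x :: real where x: "x \<notin> \<rat>"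
    using countable_rat uncountable_UNIV_real by (metis UNIV_eq_I)
  \<comment> \<open>Irrational arguments converging to \<open>q\<close>: a rational shift of a
    rational multiple of an irrational number.\<close>
  define t where "t k = q + x / real (Suc k)" for k
  have irr: "t k \<notin> \<rat>" for k
  proof
    assume "t k \<in> \<rat>"
    then have "(t k - q) * of_nat (Suc k) \<in> \<rat>"
      using assms(1) by (intro Rats_mult Rats_diff) auto
    moreover have "(t k - q) * of_nat (Suc k) = x"
      unfolding t_def by simp
    ultimately show False
      using x by simp
  qed
  have "t \<longlonglongrightarrow> q + 0"
    unfolding t_def by (intro tendsto_add tendsto_const LIMSEQ_Suc[OF lim_const_over_n])
  then have "(\<lambda>k. cmod (poly P (cis (2 * pi * t k)))) \<longlonglongrightarrow> cmod (poly P (cis (2 * pi * q)))"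
    by (intro tendsto_intros) simp
  then show False
    using assms one[OF irr] by (simp add: LIMSEQ_const_iff)
qed

theorem theorem6:
  fixes P :: "complex poly" and Qs :: "complex poly list"
  assumes "P = prod_list Qs"
    and "\<forall>Q\<in>set Qs. (\<exists>n>0. Q = cyclotomic_poly n) \<or> (\<exists>k. Q = monom 1 k)"
    and "\<nexists>k. P = monom 1 k"
  shows "m2 P \<ge> pi\<^sup>2 / 12"
proof -
  let ?p = "\<lambda>\<theta>. poly P (cis (2 * pi * \<theta>))"
  have nz: "?p \<theta> \<noteq> 0" if "\<theta> \<notin> \<rat>" for \<theta>
    using log_chord_span_prod_list[OF assms(2)] that assms(1) by simp
  obtain N b where b: "ln (cmod (?p \<theta>)) = (\<Sum>a=1..N. of_int (b a :: int) * log_chord (real a * \<theta>))"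
    if "\<theta> \<notin> \<rat>" for \<theta>
    using log_chord_span_prod_list[OF assms(2)] assms(1) unfolding log_chord_span_def by blast
  define A where "A = {1..N}"
  define g where "g \<theta> = (\<Sum>a\<in>A. of_int (b a) * log_chord (real a * \<theta>))" for \<theta>
  have ln_p: "ln (cmod (?p \<theta>)) = g \<theta>" if "\<theta> \<notin> \<rat>" for \<theta>
    unfolding g_def A_def using b[OF that] by simp
  \<comment> \<open>If all coefficients vanished, \<open>P\<close> would have modulus 1 at
    irrational arguments. As \<open>P\<close> is not a monomial, some factor is cyclotomic and gives
    a root at a rational argument.\<close>
  have "\<exists>a\<in>A. b a \<noteq> 0"
  proof (rule ccontr)
    assume "\<not> ?thesis"
    then have "cmod (?p \<theta>) = 1" if "\<theta> \<notin> \<rat>" for \<theta>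
      using ln_p[OF that] nz[OF that] by (simp add: g_def)
    moreover obtain n where "n > 0" "cyclotomic_poly n \<in> set Qs"
      using prod_list_monom[of Qs] assms by metis
    then have "poly P (cis (2 * pi * (1 / real n))) = 0"
      using cyclotomic_poly_root[of n] by (auto simp: assms(1) dest!: split_list)
    ultimately show False
      using not_unimodular_if_root_on_circle[of "1 / real n" P] by auto
  qed
  \<comment> \<open>Passes from the closed interval in \<open>m2\<close> to the half-open period
    used for the correlations.\<close>
  have AE_Ico: "set_lebesgue_integral lborel {0..1} h = set_lebesgue_integral lborel {0..<1} h"
    if [measurable]: "h \<in> borel_measurable borel" for h :: "real \<Rightarrow> real"
    unfolding set_lebesgue_integral_def
  proof (rule integral_cong_AE)
    show "AE \<theta> in lborel. indicator {0..1} \<theta> *\<^sub>R h \<theta> = indicator {0..<1} \<theta> *\<^sub>R h \<theta>"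
      using AE_lborel_singleton[of "1::real"] by eventually_elim (auto simp: indicator_def)
  qed measurable
  have sq: "set_integrable lborel {0..<1} (\<lambda>\<theta>. (log_chord \<theta>)\<^sup>2)"
    by (rule set_integrable_subset[OF set_integral_log_chord_square(1)]) auto
  have pos: "a > 0" if "a \<in> A" for a
    using that by (simp add: A_def)
  have [measurable]: "g \<in> borel_measurable borel"
    unfolding g_def by measurable
  have [measurable]: "?p \<in> borel_measurable borel"
    by (intro borel_measurable_continuous_onI continuous_intros)
  have "m2 P = (LBINT \<theta>:{0..1}. (ln (cmod (?p \<theta>)))\<^sup>2)"
    unfolding m2_def by (simp add: cis_conv_exp mult_ac)
  also have "\<dots> = (LBINT \<theta>:{0..1}. (g \<theta>)\<^sup>2)"
  proof (rule set_lebesgue_integral_cong_AE)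
    show "AE \<theta>\<in>{0..1} in lborel. (ln (cmod (?p \<theta>)))\<^sup>2 = (g \<theta>)\<^sup>2"
      using AE_irrational by eventually_elim (simp add: ln_p)
  qed measurable
  also have "\<dots> = (LBINT \<theta>:{0..<1}. (\<Sum>a\<in>A. \<Sum>c\<in>A. of_int (b a) * of_int (b c) * (log_chord (real a * \<theta>) * log_chord (real c * \<theta>))))"
    by (subst AE_Ico) (simp_all add: g_def power2_eq_square sum_product mult_ac)
  also have "\<dots> = (\<Sum>a\<in>A. \<Sum>c\<in>A. of_int (b a) * of_int (b c) * (LBINT \<theta>:{0..<1}. log_chord (real a * \<theta>) * log_chord (real c * \<theta>)))"
  proof -
    have int: "set_integrable lborel {0..<1} (\<lambda>\<theta>. of_int (b a) * of_int (b c) * (log_chord (real a * \<theta>) * log_chord (real c * \<theta>)))"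
      if "a \<in> A" "c \<in> A" for a c
      by (intro set_integrable_mult_right impI set_integrable_log_chord_mult sq pos that)
    let ?X = "\<lambda>a c \<theta>. of_int (b a) * of_int (b c) * (log_chord (real a * \<theta>) * log_chord (real c * \<theta>))"
    have "(LBINT \<theta>:{0..<1}. (\<Sum>a\<in>A. \<Sum>c\<in>A. ?X a c \<theta>)) = (LBINT \<theta>. \<Sum>a\<in>A. \<Sum>c\<in>A. indicator {0..<1} \<theta> *\<^sub>R ?X a c \<theta>)"
      unfolding set_lebesgue_integral_def scaleR_sum_right ..
    also have "\<dots> = (\<Sum>a\<in>A. \<Sum>c\<in>A. LBINT \<theta>:{0..<1}. ?X a c \<theta>)"
      using int unfolding set_lebesgue_integral_def set_integrable_def
      by (simp only: Bochner_Integration.integral_sum Bochner_Integration.integrable_sum cong: sum.cong)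
    finally show ?thesis
      by simp
  qed
  also have "\<dots> = (\<Sum>a\<in>A. \<Sum>c\<in>A. of_int (b a) * of_int (b c) * ((real (gcd a c))\<^sup>2 / (real a * real c))) * (pi\<^sup>2 / 12)"
  proof -
    have sq_val: "(LBINT \<theta>:{0..<1}. (log_chord \<theta>)\<^sup>2) = pi\<^sup>2 / 12"
      using set_integral_log_chord_square(2) by (subst (asm) AE_Ico) simp_all
    show ?thesis
      unfolding sum_distrib_right
      by (intro sum.cong refl) (simp add: set_integral_log_chord_mult[OF sq pos pos] sq_val)
  qed
  also have "\<dots> \<ge> 1 * (pi\<^sup>2 / 12)"
    using pos \<open>\<exists>a\<in>A. b a \<noteq> 0\<close> by (intro mult_right_mono gcd_form_ge_1) (auto simp: A_def)
  finally show ?thesis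
    by simp
qed

end
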